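(* Let $A_{cl}\in\mathbb{R}^{n\times n}$ and $B_{cl}\in\mathbb{R}^{n\times m}$. There exist a scalar $\alpha_{con}>0$ and a symmetric matrix $Q_2=P^{-1}>0$ such that $$\left(\begin{array}{cc} A_{cl}Q_2+Q_2A_{cl}^T+\alpha_{con}Q_2 & B_{cl}\\ \star & -\alpha_{con}I\end{array}\right)<0$$ if and only if there exist a square matrix $G_2\in\mathbb{R}^{n\times n}$, a constant $0<\epsilon_2<1$ and a symmetric matrix $X_2=P^{-1}>0$ which satisfy, for some $\alpha_{new}>0$, $$\left(\begin{array}{ccc} X_2 & B_{cl} & -X_2\\ \star & -\alpha_{new}I & 0\\ \star & \star & 0\end{array}\right)+\mathbf{He}(\mathcal{Q}^TG_2\mathcal{P})<0,$$ where $\mathcal{P}=[\,I\quad 0\quad -2\epsilon_2 I\,]$, $\mathcal{Q}=[\,(\hat A^T-\tfrac12 I)\quad 0\quad I\,]$ and $\hat A=A_{cl}+\frac{\alpha_{new}}{2}I$.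
   Context: $\mathbf{He}(A)=A+A^T$. The symbol $\star$ denotes entries determined by symmetry. For symmetric matrices, $M>0$ ($M<0$) means positive (negative) definite; $G_2$ need not be symmetric. $\mathcal{P}$ and $\mathcal{Q}$ are partitioned conformally with the $3\times 3$ block matrix (block sizes $n,m,n$). Here $P>0$ denotes the matrix of the ellipsoid $\{x\mid x^TPx<w_{max}^2\}$ (a reachable/invariant set of $\dot x=A_{cl}x+B_{cl}w$ under disturbances with $w(t)^Tw(t)\le w_{max}^2$). *)

theory Defs
  imports "HOL-Analysis.Analysis"
begin

text \<open>Block matrices are indexed by sum types.  Both operators bind weaker than arithmetic and
  stronger than equality, and juxtaposition binds stronger than stacking, so
  \<open>A ||| B === C ||| D\<close> is the 2-by-2 block matrix with rows \<open>A, B\<close> and \<open>C, D\<close>.\<close>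

definition hcat :: "real^'a^'r \<Rightarrow> real^'b^'r \<Rightarrow> real^('a + 'b)^'r"  (infixr \<open>|||\<close> 55)
  where "A ||| B = (\<chi> i j. case j of Inl a \<Rightarrow> A $ i $ a | Inr b \<Rightarrow> B $ i $ b)"

definition vcat :: "real^'c^'p \<Rightarrow> real^'c^'q \<Rightarrow> real^'c^('p + 'q)"  (infixr \<open>===\<close> 52)
  where "A === B = (\<chi> i. case i of Inl p \<Rightarrow> A $ p | Inr q \<Rightarrow> B $ q)"

definition sym_block2 ::
    "real^'a^'a \<Rightarrow> real^'b^'a \<Rightarrow> real^'b^'b \<Rightarrow> real^('a + 'b)^('a + 'b)"
  where "sym_block2 M11 M12 M22 =
    (M11           ||| M12
 === transpose M12 ||| M22)"

definition sym_block3 ::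
    "real^'a^'a \<Rightarrow> real^'b^'a \<Rightarrow> real^'c^'a \<Rightarrow> real^'b^'b \<Rightarrow> real^'c^'b \<Rightarrow> real^'c^'c
      \<Rightarrow> real^('a + 'b + 'c)^('a + 'b + 'c)"
  where "sym_block3 M11 M12 M13 M22 M23 M33 =
    (M11           ||| M12           ||| M13
 === transpose M12 ||| M22           ||| M23
 === transpose M13 ||| transpose M23 ||| M33)"

definition pos_def :: "real^'k^'k \<Rightarrow> bool"
  where "pos_def M \<longleftrightarrow> transpose M = M \<and> (\<forall>x. x \<noteq> 0 \<longrightarrow> 0 < x \<bullet> (M *v x))"

definition neg_def :: "real^'k^'k \<Rightarrow> bool"
  where "neg_def M \<longleftrightarrow> transpose M = M \<and> (\<forall>x. x \<noteq> 0 \<longrightarrow> x \<bullet> (M *v x) < 0)"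

definition He :: "real^'k^'k \<Rightarrow> real^'k^'k"
  where "He M = M + transpose M"

definition con_matrix ::
    "real^'n^'n \<Rightarrow> real^'m^'n \<Rightarrow> real \<Rightarrow> real^'n^'n \<Rightarrow> real^('n + 'm)^('n + 'm)"
  where "con_matrix A B \<alpha> Q =
    sym_block2 (A ** Q + Q ** transpose A + \<alpha> *\<^sub>R Q) B
                                                     (- (\<alpha> *\<^sub>R mat 1))"

definition P_row :: "real \<Rightarrow> real^('n + 'm::finite + 'n)^'n"
  where "P_row \<epsilon> = (mat 1 ||| 0 ||| - ((2 * \<epsilon>) *\<^sub>R mat 1))"

definition A_hat :: "real^'n^'n \<Rightarrow> real \<Rightarrow> real^'n^'n"
  where "A_hat A \<alpha> = A + (\<alpha> / 2) *\<^sub>R mat 1"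

definition Q_row :: "real^'n^'n \<Rightarrow> real \<Rightarrow> real^('n + 'm::finite + 'n)^'n"
  where "Q_row A \<alpha> = (transpose (A_hat A \<alpha>) - (1 / 2) *\<^sub>R mat 1 ||| 0 ||| mat 1)"

definition new_matrix ::
    "real^'n^'n \<Rightarrow> real^'m^'n \<Rightarrow> real \<Rightarrow> real \<Rightarrow> real^'n^'n \<Rightarrow> real^'n^'n
      \<Rightarrow> real^('n + 'm + 'n)^('n + 'm + 'n)"
  where "new_matrix A B \<alpha> \<epsilon> G X =
    sym_block3 X B                    (- X)
                 (- (\<alpha> *\<^sub>R mat 1)) 0
                                      0
    + He (transpose (Q_row A \<alpha>) ** G ** P_row \<epsilon>)"

end

theory Submission
  imports Defs
begin

text \<open>
  Write \<open>K = transpose (A_hat A \<alpha>) - I/2\<close>, so that \<open>P_row \<epsilon>\<close> and \<open>Q_row A \<alpha>\<close> send the block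
  vector \<open>(x, w, z)\<close> to \<open>x - 2 \<epsilon> z\<close> and \<open>q = K x + z\<close>.  Replacing the coordinate \<open>z\<close> by \<open>q\<close> is an
  invertible substitution, and in the coordinates \<open>(x, w, q)\<close> the quadratic form of the 3-by-3
  (dilated) matrix is

    \<open>F(x, w) - 2 (X x \<bullet> q) + 2 (q \<bullet> G (R x - 2 \<epsilon> q))\<close>  with  \<open>R = I + 2 \<epsilon> K\<close>,

  where \<open>F\<close> is exactly the quadratic form of the 2-by-2 (undilated) matrix for the same \<open>\<alpha>\<close> and
  the same \<open>X\<close>.  This identity is \<open>quadform_new_matrix\<close>.

  Restricting to \<open>q = 0\<close> shows that the dilated inequality implies the undilated one.  Conversely,
  the multiplier \<open>G = X R\<inverse>\<close> cancels the cross term and leaves \<open>F(x, w) - 4 \<epsilon> (q \<bullet> G q)\<close>.  It remains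
  to see that \<open>R\<close> is invertible and \<open>G\<close> has positive quadratic form; substituting \<open>q = R y\<close>, both
  follow from positivity of \<open>y \<bullet> X R y = y \<bullet> X y + 2 \<epsilon> (y \<bullet> X K y)\<close> for \<open>y \<noteq> 0\<close>, which holds for
  small \<open>\<epsilon>\<close> because \<open>X\<close> is uniformly positive on the unit sphere
  (\<open>pos_def_small_perturbation\<close>).

  The equivalence therefore holds for each fixed \<open>X\<close> and \<open>\<alpha>\<close> separately, and the theorem follows by
  quantifying over these.
\<close>

section \<open>Block vectors and quadratic forms of block matrices\<close>

text \<open>Products \<open>transpose A *v x\<close> must not turn into \<open>x v* A\<close>, since \<open>inner_transpose_mult\<close> moves
  transposes across inner products by rewriting.\<close>

declare transpose_matrix_vector [simp del]

definition vjoin :: "real^'a \<Rightarrow> real^'b \<Rightarrow> real^('a + 'b)"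
  where "vjoin x y = (\<chi> i. case i of Inl a \<Rightarrow> x $ a | Inr b \<Rightarrow> y $ b)"

lemma vjoin_cases: obtains x y where "v = vjoin x y"
proof
  show "v = vjoin (\<chi> a. v $ Inl a) (\<chi> b. v $ Inr b)"
    by (simp add: vec_eq_iff vjoin_def split: sum.split)
qed

lemma sum_UNIV_Plus:
  fixes f :: "'a::finite + 'b::finite \<Rightarrow> 'c::comm_monoid_add"
  shows "sum f UNIV = (\<Sum>a\<in>UNIV. f (Inl a)) + (\<Sum>b\<in>UNIV. f (Inr b))"
  by (simp add: sum.Plus flip: UNIV_Plus_UNIV)

lemma inner_vjoin: "vjoin x y \<bullet> vjoin x' y' = x \<bullet> x' + y \<bullet> y'"
  by (simp add: inner_vec_def vjoin_def sum_UNIV_Plus)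

lemma vjoin_eq_0_iff: "vjoin x y = 0 \<longleftrightarrow> x = 0 \<and> y = 0"
  by (auto simp: vec_eq_iff vjoin_def split: sum.split)

lemma hcat_mult_vjoin: "(A ||| B) *v vjoin x y = A *v x + B *v y"
  by (simp add: vec_eq_iff matrix_vector_mult_def hcat_def vjoin_def sum_UNIV_Plus)

lemma vcat_mult: "(A === B) *v x = vjoin (A *v x) (B *v x)"
  by (simp add: vec_eq_iff matrix_vector_mult_def vcat_def vjoin_def split: sum.split)

lemma inner_transpose_mult: "x \<bullet> (transpose A *v y) = (A *v x) \<bullet> (y :: real^'n)"
  by (metis dot_lmul_matrix inner_commute transpose_matrix_vector)

lemma transpose_sym_block2:
  "transpose (sym_block2 A B C) = sym_block2 (transpose A) B (transpose C)"
  by (simp add: vec_eq_iff transpose_def sym_block2_def hcat_def vcat_def split: sum.split)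

lemma transpose_sym_block3:
  "transpose (sym_block3 A B C D E F) = sym_block3 (transpose A) B C (transpose D) E (transpose F)"
  by (simp add: vec_eq_iff transpose_def sym_block3_def hcat_def vcat_def split: sum.split)

lemma quadform_sym_block2:
  "vjoin x y \<bullet> (sym_block2 A B C *v vjoin x y)
    = x \<bullet> (A *v x) + 2 * (x \<bullet> (B *v y)) + y \<bullet> (C *v y)"
  by (simp add: sym_block2_def hcat_mult_vjoin vcat_mult inner_vjoin inner_add_right
      inner_transpose_mult inner_commute)

lemma quadform_sym_block3:
  "vjoin x (vjoin y z) \<bullet> (sym_block3 A B C D E F *v vjoin x (vjoin y z))
    = x \<bullet> (A *v x) + y \<bullet> (D *v y) + z \<bullet> (F *v z)
      + 2 * (x \<bullet> (B *v y)) + 2 * (x \<bullet> (C *v z)) + 2 * (y \<bullet> (E *v z))"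
  by (simp add: sym_block3_def hcat_mult_vjoin vcat_mult inner_vjoin inner_add_right
      inner_transpose_mult inner_commute)

lemma transpose_add: "transpose (A + B) = transpose A + transpose B"
  by (simp add: vec_eq_iff transpose_def)

lemma transpose_uminus: "transpose (- A) = - transpose (A :: real^'n^'m)"
  by (simp add: vec_eq_iff transpose_def)

lemma transpose_scaleR: "transpose (c *\<^sub>R A) = c *\<^sub>R transpose (A :: real^'n^'m)"
  by (simp add: vec_eq_iff transpose_def)

lemma transpose_zero: "transpose (0 :: real^'n^'m) = 0"
  by (simp add: vec_eq_iff transpose_def)

lemma uminus_mult_vec: "(- A) *v x = - (A *v (x :: real^'n))"
  by (simp add: vec_eq_iff matrix_vector_mult_def sum_negf)

lemma transpose_He: "transpose (He M) = He M"
  by (simp add: He_def transpose_add)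

lemma quadform_He: "v \<bullet> (He M *v v) = 2 * (v \<bullet> (M *v v))"
  by (simp add: He_def matrix_vector_mult_add_rdistrib inner_add_right inner_transpose_mult
      inner_commute)

section \<open>The two matrix inequalities as quadratic forms\<close>

definition K_mat :: "real^'n^'n \<Rightarrow> real \<Rightarrow> real^'n^'n"
  where "K_mat A \<alpha> = transpose (A_hat A \<alpha>) - (1 / 2) *\<^sub>R mat 1"

lemma K_mat_mult: "K_mat A \<alpha> *v x = transpose A *v x + ((\<alpha> - 1) / 2) *\<^sub>R x"
  by (simp add: K_mat_def A_hat_def transpose_add transpose_scaleR transpose_mat
      matrix_vector_mult_add_rdistrib matrix_vector_mult_diff_rdistrib
      scaleR_matrix_vector_assoc[symmetric] scaleR_diff_left[symmetric] add_diff_eq[symmetric]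
      diff_divide_distrib)

lemma P_row_mult: "P_row \<epsilon> *v vjoin x (vjoin w z) = x - (2 * \<epsilon>) *\<^sub>R z"
  by (simp add: P_row_def hcat_mult_vjoin uminus_mult_vec scaleR_matrix_vector_assoc[symmetric])

lemma Q_row_mult: "Q_row A \<alpha> *v vjoin x (vjoin w z) = K_mat A \<alpha> *v x + z"
  by (simp add: Q_row_def K_mat_def hcat_mult_vjoin)

lemma transpose_con_matrix:
  assumes "transpose X = X"
  shows "transpose (con_matrix A B \<alpha> X) = con_matrix A B \<alpha> X"
  by (simp add: con_matrix_def transpose_sym_block2 transpose_add transpose_scaleR
      transpose_uminus transpose_mat matrix_transpose_mul assms add.commute)

lemma transpose_new_matrix:
  assumes "transpose X = X"
  shows "transpose (new_matrix A B \<alpha> \<epsilon> G X) = new_matrix A B \<alpha> \<epsilon> G X"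
  by (simp add: new_matrix_def transpose_sym_block3 transpose_add transpose_scaleR
      transpose_uminus transpose_zero transpose_mat transpose_He assms)

text \<open>Both diagonal terms \<open>A X\<close> and \<open>X A\<^sup>T\<close> contribute the same amount, and \<open>\<alpha> X\<close> is absorbed
  into \<open>K\<close> up to the summand \<open>X\<close>, which is the origin of the block \<open>X\<close> in the dilated matrix.\<close>

lemma quadform_con_matrix:
  assumes "transpose X = X"
  shows "vjoin x w \<bullet> (con_matrix A B \<alpha> X *v vjoin x w)
    = x \<bullet> (X *v x) + 2 * ((X *v x) \<bullet> (K_mat A \<alpha> *v x)) + 2 * (x \<bullet> (B *v w)) - \<alpha> * (w \<bullet> w)"
proof -
  have "x \<bullet> (X *v (transpose A *v x)) = (X *v x) \<bullet> (transpose A *v x)"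
    using inner_transpose_mult[of x X] assms by simp
  moreover have "x \<bullet> (A *v (X *v x)) = (X *v x) \<bullet> (transpose A *v x)"
    by (metis inner_transpose_mult transpose_transpose inner_commute)
  ultimately show ?thesis
    by (simp add: con_matrix_def quadform_sym_block2 matrix_vector_mult_add_rdistrib
        matrix_vector_mul_assoc[symmetric] scaleR_matrix_vector_assoc[symmetric]
        uminus_mult_vec inner_add_right K_mat_mult inner_commute field_simps)
qed

text \<open>Evaluating at \<open>z = q - K x\<close> parametrises block vectors by \<open>(x, w, q)\<close>, with \<open>q\<close> the value
  of the row \<open>Q\<close>; the form then splits into the undilated form and terms containing \<open>q\<close>.\<close>

lemma quadform_new_matrix:
  fixes A :: "real^'n^'n" and \<alpha> :: real
  assumes "transpose X = X"
  defines "K \<equiv> K_mat A \<alpha>"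
  shows "vjoin x (vjoin w (q - K *v x)) \<bullet> (new_matrix A B \<alpha> \<epsilon> G X *v vjoin x (vjoin w (q - K *v x)))
    = vjoin x w \<bullet> (con_matrix A B \<alpha> X *v vjoin x w) - 2 * ((X *v x) \<bullet> q)
      + 2 * (q \<bullet> (G *v ((mat 1 + (2 * \<epsilon>) *\<^sub>R K) *v x - (2 * \<epsilon>) *\<^sub>R q)))"
proof -
  let ?v = "vjoin x (vjoin w (q - K *v x))"
  have X: "x \<bullet> (X *v y) = (X *v x) \<bullet> y" for y
    using inner_transpose_mult[of x X] assms by simp
  have P: "P_row \<epsilon> *v ?v = (mat 1 + (2 * \<epsilon>) *\<^sub>R K) *v x - (2 * \<epsilon>) *\<^sub>R q"
    by (simp add: P_row_mult matrix_vector_mult_add_rdistrib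
        scaleR_matrix_vector_assoc[symmetric] algebra_simps)
  have "?v \<bullet> (He (transpose (Q_row A \<alpha>) ** G ** P_row \<epsilon>) *v ?v)
      = 2 * ((Q_row A \<alpha> *v ?v) \<bullet> (G *v (P_row \<epsilon> *v ?v)))"
    by (simp add: quadform_He matrix_vector_mul_assoc[symmetric] inner_transpose_mult)
  also have "\<dots> = 2 * (q \<bullet> (G *v ((mat 1 + (2 * \<epsilon>) *\<^sub>R K) *v x - (2 * \<epsilon>) *\<^sub>R q)))"
    unfolding P by (simp add: Q_row_mult K_def)
  finally have He: "?v \<bullet> (He (transpose (Q_row A \<alpha>) ** G ** P_row \<epsilon>) *v ?v) = \<dots>" .
  show ?thesis
    unfolding new_matrix_def matrix_vector_mult_add_rdistrib inner_add_right He
      quadform_sym_block3 quadform_con_matrix[OF assms(1)]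
    by (simp add: uminus_mult_vec scaleR_matrix_vector_assoc[symmetric] X K_def inner_diff_right)
qed

section \<open>Choosing the constant and the multiplier\<close>

text \<open>By compactness the form \<open>X\<close> is at least \<open>c > 0\<close> on the unit sphere, while the form \<open>M\<close> is
  bounded there by its operator norm.\<close>

lemma pos_def_small_perturbation:
  fixes X M :: "real^'n^'n"
  assumes "pos_def X"
  obtains \<epsilon> where "0 < \<epsilon>" "\<epsilon> < 1"
    "\<forall>y. y \<noteq> 0 \<longrightarrow> 0 < y \<bullet> (X *v y) + 2 * \<epsilon> * (y \<bullet> (M *v y))"
proof -
  let ?S = "sphere 0 1 :: (real^'n) set"
  have "axis undefined 1 \<in> ?S"
    by simp
  moreover have "continuous_on ?S (\<lambda>y. y \<bullet> (X *v y))"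
    by (intro continuous_intros)
  ultimately obtain u where u: "u \<in> ?S" "\<And>y. y \<in> ?S \<Longrightarrow> u \<bullet> (X *v u) \<le> y \<bullet> (X *v y)"
    using continuous_attains_inf[of ?S "\<lambda>y. y \<bullet> (X *v y)"] by (metis compact_sphere empty_iff)
  define c where "c = u \<bullet> (X *v u)"
  define m where "m = onorm ((*v) M)"
  have "u \<noteq> 0"
    using u(1) by auto
  then have c: "c > 0"
    using assms by (simp add: c_def pos_def_def)
  have m: "m \<ge> 0" "\<bar>y \<bullet> (M *v y)\<bar> \<le> m * (norm y)\<^sup>2" for y
  proof -
    show "m \<ge> 0"
      by (simp add: m_def onorm_pos_le)
    have "\<bar>y \<bullet> (M *v y)\<bar> \<le> norm y * norm (M *v y)"
      by (rule Cauchy_Schwarz_ineq2)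
    also have "\<dots> \<le> norm y * (m * norm y)"
      unfolding m_def by (intro mult_left_mono onorm) simp_all
    finally show "\<bar>y \<bullet> (M *v y)\<bar> \<le> m * (norm y)\<^sup>2"
      by (simp add: power2_eq_square mult_ac)
  qed
  have lower: "c * (norm y)\<^sup>2 \<le> y \<bullet> (X *v y)" if "y \<noteq> 0" for y
  proof -
    have "c \<le> (y /\<^sub>R norm y) \<bullet> (X *v (y /\<^sub>R norm y))"
      unfolding c_def by (rule u(2)) (simp add: that)
    also have "\<dots> = (y \<bullet> (X *v y)) / (norm y)\<^sup>2"
      by (simp add: matrix_vector_mult_scaleR power2_eq_square divide_inverse)
    finally show ?thesis
      using that by (simp add: pos_le_divide_eq)
  qed
  \<comment> \<open>The denominator is chosen so that both \<open>\<epsilon> < 1\<close> and \<open>2 * \<epsilon> * m < c\<close>.\<close>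
  define \<epsilon> where "\<epsilon> = c / (c + 2 * m + 1)"
  have \<epsilon>: "0 < \<epsilon>" "\<epsilon> < 1"
    using c m(1) by (simp_all add: \<epsilon>_def)
  have "2 * m * c < c * (c + 2 * m + 1)"
    using c by (simp add: algebra_simps add_pos_pos)
  then have small: "2 * \<epsilon> * m < c"
    using c m(1) by (simp add: \<epsilon>_def divide_simps mult_ac)
  have "0 < y \<bullet> (X *v y) + 2 * \<epsilon> * (y \<bullet> (M *v y))" if "y \<noteq> 0" for y
  proof -
    have "\<bar>2 * \<epsilon> * (y \<bullet> (M *v y))\<bar> \<le> 2 * \<epsilon> * (m * (norm y)\<^sup>2)"
      using m(2)[of y] \<epsilon> by (simp add: abs_mult)
    also have "\<dots> < c * (norm y)\<^sup>2"
      using small that by (simp add: mult.assoc[symmetric])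
    finally show ?thesis
      using lower[OF that] by linarith
  qed
  with \<epsilon> show thesis
    using that by simp
qed

text \<open>The vectors annihilated by the row \<open>Q\<close> are the graph of \<open>(x, w) \<mapsto> - K x\<close>, and the dilated
  form restricted to this graph is the undilated form.\<close>

lemma neg_def_con_if_new:
  fixes A X :: "real^'n^'n" and B :: "real^'m^'n"
  assumes "transpose X = X" and "neg_def (new_matrix A B \<alpha> \<epsilon> G X)"
  shows "neg_def (con_matrix A B \<alpha> X)"
  unfolding neg_def_def
proof (intro conjI allI impI)
  show "transpose (con_matrix A B \<alpha> X) = con_matrix A B \<alpha> X"
    by (rule transpose_con_matrix[OF assms(1)])
  fix v :: "real^('n + 'm)" assume "v \<noteq> 0"
  obtain x w where v: "v = vjoin x w"
    by (rule vjoin_cases)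
  let ?u = "vjoin x (vjoin w (0 - K_mat A \<alpha> *v x))"
  have "?u \<noteq> 0"
    using \<open>v \<noteq> 0\<close> by (auto simp: v vjoin_eq_0_iff)
  then have "?u \<bullet> (new_matrix A B \<alpha> \<epsilon> G X *v ?u) < 0"
    using assms(2) unfolding neg_def_def by blast
  then show "v \<bullet> (con_matrix A B \<alpha> X *v v) < 0"
    unfolding quadform_new_matrix[OF assms(1)] v by simp
qed

text \<open>The multiplier is \<open>G = X R\<inverse>\<close> with \<open>R = I + 2 \<epsilon> K\<close>, where \<open>\<epsilon>\<close> is so small that \<open>X R\<close> has
  positive quadratic form.\<close>

lemma neg_def_new_if_con:
  fixes A X :: "real^'n^'n" and B :: "real^'m^'n"
  assumes "pos_def X" and "neg_def (con_matrix A B \<alpha> X)"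
  obtains G \<epsilon> where "0 < \<epsilon>" "\<epsilon> < 1" "neg_def (new_matrix A B \<alpha> \<epsilon> G X)"
proof -
  have symX: "transpose X = X"
    using assms(1) by (simp add: pos_def_def)
  have X: "x \<bullet> (X *v y) = (X *v x) \<bullet> y" for x y
    using inner_transpose_mult[of x X] symX by simp
  define K where "K = K_mat A \<alpha>"
  obtain \<epsilon> where \<epsilon>: "0 < \<epsilon>" "\<epsilon> < 1"
    and pos: "\<forall>y. y \<noteq> 0 \<longrightarrow> 0 < y \<bullet> (X *v y) + 2 * \<epsilon> * (y \<bullet> ((X ** K) *v y))"
    by (rule pos_def_small_perturbation[OF assms(1), where M = "X ** K"])
  define R where "R = mat 1 + (2 * \<epsilon>) *\<^sub>R K"
  have XR: "0 < y \<bullet> (X *v (R *v y))" if "y \<noteq> 0" for y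
    using pos that
    by (simp add: R_def matrix_vector_mult_add_rdistrib matrix_vector_mul_assoc[symmetric]
        scaleR_matrix_vector_assoc[symmetric] matrix_vector_right_distrib
        matrix_vector_mult_scaleR inner_add_right)
  have "y = 0" if "R *v y = 0" for y
    using XR[of y] that by (cases "y = 0") simp_all
  then obtain S where "S ** R = mat 1"
    using matrix_left_invertible_ker[of R] by blast
  moreover from this have "R ** S = mat 1"
    by (rule matrix_left_right_inverse[THEN iffD1])
  ultimately have R: "S *v (R *v y) = y" "R *v (S *v y) = y" for y
    by (simp_all add: matrix_vector_mul_assoc)
  define G where "G = X ** S"
  have GR: "G *v (R *v y) = X *v y" for y
    by (simp add: G_def matrix_vector_mul_assoc[symmetric] R)
  have G: "0 < q \<bullet> (G *v q)" if "q \<noteq> 0" for q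
  proof -
    define y where "y = S *v q"
    have q: "q = R *v y"
      by (simp add: y_def R)
    then have "y \<noteq> 0"
      using that by auto
    then show ?thesis
      using XR[of y] X[of y "R *v y"] by (simp add: q GR inner_commute)
  qed
  have "neg_def (new_matrix A B \<alpha> \<epsilon> G X)"
    unfolding neg_def_def
  proof (intro conjI allI impI)
    show "transpose (new_matrix A B \<alpha> \<epsilon> G X) = new_matrix A B \<alpha> \<epsilon> G X"
      by (rule transpose_new_matrix[OF symX])
    fix v :: "real^('n + 'm + 'n)" assume "v \<noteq> 0"
    obtain x y where "v = vjoin x y"
      by (rule vjoin_cases)
    moreover obtain w z where "y = vjoin w z"
      by (rule vjoin_cases)
    moreover define q where "q = K *v x + z"
    ultimately have v: "v = vjoin x (vjoin w (q - K *v x))"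
      by simp
    have *: "v \<bullet> (new_matrix A B \<alpha> \<epsilon> G X *v v)
        = vjoin x w \<bullet> (con_matrix A B \<alpha> X *v vjoin x w) - 4 * \<epsilon> * (q \<bullet> (G *v q))"
      unfolding v K_def quadform_new_matrix[OF symX]
      unfolding K_def[symmetric] R_def[symmetric]
      by (simp add: matrix_vector_mult_diff_distrib GR matrix_vector_mult_scaleR inner_diff_right
          inner_commute algebra_simps)
    show "v \<bullet> (new_matrix A B \<alpha> \<epsilon> G X *v v) < 0"
    proof (cases "vjoin x w = 0")
      case True
      then have "q \<noteq> 0"
        using \<open>v \<noteq> 0\<close> by (auto simp: v vjoin_eq_0_iff)
      then show ?thesis
        using G[of q] \<epsilon> True by (simp add: *)
    next
      case False
      then have "vjoin x w \<bullet> (con_matrix A B \<alpha> X *v vjoin x w) < 0"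
        using assms(2) unfolding neg_def_def by blast
      moreover have "0 \<le> q \<bullet> (G *v q)"
        using G[of q] by (cases "q = 0") simp_all
      then have "0 \<le> 4 * \<epsilon> * (q \<bullet> (G *v q))"
        using \<epsilon> by simp
      ultimately show ?thesis
        unfolding * by linarith
    qed
  qed
  with \<epsilon> show thesis
    by (rule that)
qed

lemma neg_def_con_iff_new:
  assumes "pos_def X"
  shows "neg_def (con_matrix A B \<alpha> X)
    \<longleftrightarrow> (\<exists>G \<epsilon>. 0 < \<epsilon> \<and> \<epsilon> < 1 \<and> neg_def (new_matrix A B \<alpha> \<epsilon> G X))"
proof -
  have "transpose X = X"
    using assms by (simp add: pos_def_def)
  then show ?thesis
    using neg_def_con_if_new neg_def_new_if_con[OF assms] by metis
qed

theorem theorem2: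
  fixes A_cl :: "real^'n^'n" and B_cl :: "real^'m^'n"
  shows
    "((\<exists>\<alpha>_con P Q2. \<alpha>_con > 0 \<and> pos_def P \<and> Q2 = matrix_inv P \<and> pos_def Q2 \<and>
         neg_def (con_matrix A_cl B_cl \<alpha>_con Q2))
      \<longleftrightarrow>
      (\<exists>G2 \<epsilon>2 P X2 \<alpha>_new. 0 < \<epsilon>2 \<and> \<epsilon>2 < 1 \<and> pos_def P \<and> X2 = matrix_inv P \<and> pos_def X2 \<and>
         \<alpha>_new > 0 \<and> neg_def (new_matrix A_cl B_cl \<alpha>_new \<epsilon>2 G2 X2)))
     \<and>
     (\<forall>P. pos_def P \<longrightarrow>
       ((\<exists>\<alpha>_con Q2. \<alpha>_con > 0 \<and> Q2 = matrix_inv P \<and> pos_def Q2 \<and>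
           neg_def (con_matrix A_cl B_cl \<alpha>_con Q2))
        \<longleftrightarrow>
        (\<exists>G2 \<epsilon>2 X2 \<alpha>_new. 0 < \<epsilon>2 \<and> \<epsilon>2 < 1 \<and> X2 = matrix_inv P \<and> pos_def X2 \<and>
           \<alpha>_new > 0 \<and> neg_def (new_matrix A_cl B_cl \<alpha>_new \<epsilon>2 G2 X2))))"
  (is "(?con_ex \<longleftrightarrow> ?new_ex) \<and> _")
proof -
  have equiv: "(\<exists>\<alpha> Q. \<alpha> > 0 \<and> Q = matrix_inv P \<and> pos_def Q \<and> neg_def (con_matrix A_cl B_cl \<alpha> Q))
      \<longleftrightarrow> (\<exists>G \<epsilon> X \<alpha>. 0 < \<epsilon> \<and> \<epsilon> < 1 \<and> X = matrix_inv P \<and> pos_def X \<and>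
            \<alpha> > 0 \<and> neg_def (new_matrix A_cl B_cl \<alpha> \<epsilon> G X))"
    (is "?con P \<longleftrightarrow> ?new P") for P
  proof (cases "pos_def (matrix_inv P)")
    case True
    show ?thesis
      by (simp add: True neg_def_con_iff_new[OF True]) blast
  qed auto
  have "(\<exists>P. pos_def P \<and> ?con P) \<longleftrightarrow> (\<exists>P. pos_def P \<and> ?new P)"
    by (simp only: equiv)
  moreover have "?con_ex \<longleftrightarrow> (\<exists>P. pos_def P \<and> ?con P)"
    by (rule iffI; elim exE conjE; intro exI conjI; assumption)
  moreover have "?new_ex \<longleftrightarrow> (\<exists>P. pos_def P \<and> ?new P)"
    by (rule iffI; elim exE conjE; intro exI conjI; assumption)
  ultimately have ex_equiv: "?con_ex \<longleftrightarrow> ?new_ex"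
    by (simp only:)
  show ?thesis
    by (intro conjI allI impI ex_equiv equiv)
qed

end
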